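(* For every $n\ge1$ and indices $i_1,\dots,i_n\in\{1,\dots,N\}$, setting $t=1$, $$\tilde\omega_{N,t=1}(\sigma_{i_1}\sigma_{i_2}\cdots\sigma_{i_n})=\omega_{N+1}(\sigma_{i_1}\sigma_{i_2}\cdots\sigma_{i_n}\sigma_{N+1}^n)+O(1/N)$$ as $N\to\infty$. Consequently, in the thermodynamic limit at $t=1$, the (quenched, replicated) Boltzmann average of a fillable multi-overlap monomial equals the Boltzmann average of the corresponding filled multi-overlap monomial.
   Context: Diluted two-body model: $\sigma\in\{-1,1\}^N$, $H_N(\sigma,\alpha)=-\sum_{\nu=1}^{P_{\alpha N}}\sigma_{i_\nu}\sigma_{j_\nu}$ with $P_{\alpha N}$ Poisson of mean $\alpha N$ and $\{i_\nu\},\{j_\nu\}$ i.i.d. uniform on $\{1,\dots,N\}$; $\omega_N$ is the Boltzmann state $\omega_N(g)=Z_N^{-1}\sum_\sigma g(\sigma)e^{-\beta H_N(\sigma,\alpha)}$, and $\omega_{N+1}$ is the same object for $N+1$ spins at connectivity $\alpha$. With $\tilde\alpha=\frac N{N+1}\alpha$, the $t$-dependent state is $$\tilde\omega_{N,t}(g)=\frac{1}{Z_{N,t}}\sum_\sigma g(\sigma)\exp\Big(\beta\sum_{\nu=1}^{P_{\tilde\alpha N}}\sigma_{i_\nu}\sigma_{j_\nu}+\beta\sum_{\nu=1}^{P'_{2\tilde\alpha t}}\sigma_{k_\nu}\Big),$$ $P'_{2\tilde\alpha t}$ Poisson of mean $2\tilde\alpha t$, $\{k_\nu\}$ i.i.d.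 uniform on $\{1,\dots,N\}$, independent of everything, $Z_{N,t}$ the normalization. Multi-overlaps of replicas $\sigma^{(1)},\sigma^{(2)},\dots$ (i.i.d. copies under the same quenched disorder) are $q_{a_1\cdots a_n}=\frac1N\sum_{i=1}^N\sigma_i^{(a_1)}\cdots\sigma_i^{(a_n)}$, with $m_a=q_a$. A monomial in the multi-overlaps is called filled (stochastically stable) if every replica index appears in it an even number of times (e.g. $q_{12}^2$, $m^2$, $q_{12}q_{34}q_{1234}$), and fillable otherwise (e.g. $q_{12}$, $m$, $q_{12}q_{34}$). *)

theory Defs
  imports Complex_Main
begin

text \<open>Spin configurations on sites 1..N (sites outside 1..N are frozen to 1 and irrelevant).\<close>
definition spins :: "nat \<Rightarrow> (nat \<Rightarrow> real) set" where
  "spins N = {\<sigma>. (\<forall>i\<in>{1..N}. \<sigma> i = -1 \<or> \<sigma> i = 1) \<and> (\<forall>i. i \<notin> {1..N} \<longrightarrow> \<sigma> i = 1)}"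

text \<open>Boltzmann weight exp(beta sum_nu sigma_{i_nu} sigma_{j_nu} + beta sum_nu sigma_{k_nu})
  for a realisation of the links es = [(i_nu,j_nu)] and one-body fields ks = [k_nu].\<close>
definition bweight :: "real \<Rightarrow> (nat \<times> nat) list \<Rightarrow> nat list \<Rightarrow> (nat \<Rightarrow> real) \<Rightarrow> real" where
  "bweight \<beta> es ks \<sigma> = exp (\<beta> * (\<Sum>(i,j)\<leftarrow>es. \<sigma> i * \<sigma> j) + \<beta> * (\<Sum>k\<leftarrow>ks. \<sigma> k))"

definition gibbs :: "nat \<Rightarrow> real \<Rightarrow> (nat \<times> nat) list \<Rightarrow> nat list \<Rightarrow> ((nat \<Rightarrow> real) \<Rightarrow> real) \<Rightarrow> real" where
  "gibbs N \<beta> es ks g =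
     (\<Sum>\<sigma>\<in>spins N. g \<sigma> * bweight \<beta> es ks \<sigma>) / (\<Sum>\<sigma>\<in>spins N. bweight \<beta> es ks \<sigma>)"

definition mono :: "nat list \<Rightarrow> (nat \<Rightarrow> real) \<Rightarrow> real" where
  "mono I \<sigma> = (\<Prod>i\<leftarrow>I. \<sigma> i)"

definition poi :: "real \<Rightarrow> nat \<Rightarrow> real" where
  "poi lam p = exp (- lam) * lam ^ p / fact p"

definition unif_avg :: "'a set \<Rightarrow> nat \<Rightarrow> ('a list \<Rightarrow> real) \<Rightarrow> real" where
  "unif_avg S p F = (\<Sum>xs\<in>{xs. set xs \<subseteq> S \<and> length xs = p}. F xs) / real (card S) ^ p"

definition qexp :: "nat \<Rightarrow> real \<Rightarrow> real \<Rightarrow> ((nat \<times> nat) list \<Rightarrow> nat list \<Rightarrow> real) \<Rightarrow> real" where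
  "qexp N lam mu F =
     (\<Sum>p. \<Sum>q. poi lam p * poi mu q *
        unif_avg ({1..N} \<times> {1..N}) p (\<lambda>es. unif_avg {1..N} q (\<lambda>ks. F es ks)))"

definition alpha_tilde :: "nat \<Rightarrow> real \<Rightarrow> real" where
  "alpha_tilde N \<alpha> = real N / real (N + 1) * \<alpha>"

end

theory Submission
  imports Defs "HOL-Analysis.Infinite_Sum" "HOL-Library.Multiset"
begin

(* The cavity identity at t = 1.
   The quenched average of a product of Boltzmann moments of the (N+1)-spin diluted
   model, each moment carrying the gauge factor sigma_{N+1}^n, equals the corresponding
   average for the N-spin model in which the links touching the cavity spin N+1 are
   replaced by Poisson(2 alpha~) one-body fields.  In the present (exact) formalisation
   the identity holds with no error term at all, so the O(1/N) bound holds with C = 0.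

   The proof has three ingredients, developed in this order:
   (1) Poisson thinning: a Poisson(L) number of i.i.d. uniform draws from a disjoint union
       S1 \<union> S2 splits into independent Poisson numbers of uniform draws from S1 and S2,
       for observables invariant under permutations of the draws;
   (2) gauge symmetry: flipping all N+1 spins removes the factor sigma_{N+1}^n, so the
       (N+1)-spin moments equal N-spin moments with sigma_{N+1} frozen to 1;
   (3) with sigma_{N+1} = 1, a link (k, N+1) or (N+1, k) acts as a field on k and the
       self-loop (N+1, N+1) only rescales the weight. *)

abbreviation tuples :: "'a set \<Rightarrow> nat \<Rightarrow> 'a list set" where
  "tuples S p \<equiv> {xs. set xs \<subseteq> S \<and> length xs = p}"

lemma tuples_0: "tuples S 0 = {[]}"
  by auto

lemma sum_tuples_Suc:
  assumes "finite S"
  shows "(\<Sum>xs\<in>tuples S (Suc p). f xs) = (\<Sum>x\<in>S. \<Sum>xs\<in>tuples S p. f (x # xs))"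
proof -
  have img: "tuples S (Suc p) = (\<lambda>(x, xs). x # xs) ` (S \<times> tuples S p)"
    by (auto simp: length_Suc_conv image_iff)
  have inj: "inj_on (\<lambda>(x, xs). x # xs) (S \<times> tuples S p)"
    by (auto simp: inj_on_def)
  show ?thesis
    unfolding img sum.reindex[OF inj] by (simp add: sum.cartesian_product split_def)
qed

definition perm_invariant :: "('a list \<Rightarrow> real) \<Rightarrow> bool" where
  "perm_invariant \<Phi> \<longleftrightarrow> (\<forall>xs ys. mset xs = mset ys \<longrightarrow> \<Phi> xs = \<Phi> ys)"

lemma perm_invariantD: "perm_invariant \<Phi> \<Longrightarrow> mset xs = mset ys \<Longrightarrow> \<Phi> xs = \<Phi> ys"
  unfolding perm_invariant_def by blast

lemma perm_invariant_append: "perm_invariant \<Phi> \<Longrightarrow> perm_invariant (\<lambda>l. \<Phi> (xs @ l))"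
  unfolding perm_invariant_def by simp

definition split_sum :: "'a set \<Rightarrow> 'a set \<Rightarrow> ('a list \<Rightarrow> real) \<Rightarrow> nat \<Rightarrow> nat \<Rightarrow> real" where
  "split_sum S1 S2 \<Phi> a b = (\<Sum>ys\<in>tuples S1 a. \<Sum>zs\<in>tuples S2 b. \<Phi> (ys @ zs))"

(* Peeling one draw off either block of a split sample; for the second block the
   draw has to be moved to the front, which needs permutation invariance. *)
lemma split_sum_Suc_left:
  assumes "finite S1"
  shows "(\<Sum>x\<in>S1. split_sum S1 S2 (\<lambda>l. \<Phi> (x # l)) a b) = split_sum S1 S2 \<Phi> (Suc a) b"
  unfolding split_sum_def by (simp add: sum_tuples_Suc[OF assms])

lemma split_sum_Suc_right:
  assumes "finite S2" and perm: "perm_invariant \<Phi>"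
  shows "(\<Sum>x\<in>S2. split_sum S1 S2 (\<lambda>l. \<Phi> (x # l)) a b) = split_sum S1 S2 \<Phi> a (Suc b)"
proof -
  have "split_sum S1 S2 \<Phi> a (Suc b) = (\<Sum>ys\<in>tuples S1 a. \<Sum>x\<in>S2. \<Sum>zs\<in>tuples S2 b. \<Phi> (x # ys @ zs))"
    unfolding split_sum_def sum_tuples_Suc[OF assms(1)] by (intro sum.cong refl perm_invariantD[OF perm]) simp
  also have "\<dots> = (\<Sum>x\<in>S2. split_sum S1 S2 (\<lambda>l. \<Phi> (x # l)) a b)"
    unfolding split_sum_def by (rule sum.swap)
  finally show ?thesis ..
qed

lemma pascal_recombine:
  fixes T :: "nat \<Rightarrow> nat \<Rightarrow> real"
  shows "(\<Sum>a\<le>p. T (Suc a) (p - a) / (fact a * fact (p - a)))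
         + (\<Sum>a\<le>p. T a (Suc (p - a)) / (fact a * fact (p - a)))
       = real (Suc p) * (\<Sum>a\<le>Suc p. T a (Suc p - a) / (fact a * fact (Suc p - a)))"
proof -
  define U where "U a b = T a b / (fact a * fact b)" for a b
  have left: "(\<Sum>a\<le>p. T (Suc a) (p - a) / (fact a * fact (p - a)))
            = (\<Sum>a\<le>Suc p. real a * U a (Suc p - a))"
  proof -
    have "T (Suc a) (p - a) / (fact a * fact (p - a)) = real (Suc a) * U (Suc a) (Suc p - Suc a)" for a
      unfolding U_def fact_Suc by (simp add: field_simps del: of_nat_Suc)
    then show ?thesis by (subst sum.atMost_Suc_shift) simp
  qed
  have right: "(\<Sum>a\<le>p. T a (Suc (p - a)) / (fact a * fact (p - a)))
             = (\<Sum>a\<le>Suc p. real (Suc p - a) * U a (Suc p - a))"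
  proof -
    have "T a (Suc (p - a)) / (fact a * fact (p - a)) = real (Suc p - a) * U a (Suc p - a)"
      if "a \<le> p" for a
      unfolding U_def using that Suc_diff_le[OF that]
      by (simp add: fact_Suc field_simps del: of_nat_Suc)
    then show ?thesis by (subst sum.atMost_Suc) simp
  qed
  have combined: "(\<Sum>a\<le>Suc p. real a * U a (Suc p - a)) + (\<Sum>a\<le>Suc p. real (Suc p - a) * U a (Suc p - a))
      = (\<Sum>a\<le>Suc p. real (Suc p) * U a (Suc p - a))"
    by (subst sum.distrib[symmetric]) (auto intro!: sum.cong simp: algebra_simps of_nat_diff)
  show ?thesis
    unfolding left right combined by (simp only: U_def sum_distrib_left)
qed

lemma sum_tuples_union:
  assumes "finite S1" "finite S2" "S1 \<inter> S2 = {}"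
    and perm: "perm_invariant \<Phi>"
  shows "(\<Sum>xs\<in>tuples (S1 \<union> S2) p. \<Phi> xs)
         = fact p * (\<Sum>a\<le>p. split_sum S1 S2 \<Phi> a (p - a) / (fact a * fact (p - a)))"
  using perm
proof (induction p arbitrary: \<Phi>)
  case 0
  have "split_sum S1 S2 \<Phi> 0 0 = \<Phi> []"
    unfolding split_sum_def tuples_0 by simp
  then show ?case unfolding tuples_0 by simp
next
  case (Suc p)
  let ?D = "\<lambda>a. fact a * fact (p - a) :: real"
  have IH: "(\<Sum>xs\<in>tuples (S1 \<union> S2) p. \<Phi> (x # xs))
          = fact p * (\<Sum>a\<le>p. split_sum S1 S2 (\<lambda>l. \<Phi> (x # l)) a (p - a) / ?D a)" for x
    using Suc.IH[of "\<lambda>l. \<Phi> (x # l)"] perm_invariant_append[OF Suc.prems, of "[x]"] by simp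
  have from_S1: "(\<Sum>x\<in>S1. \<Sum>xs\<in>tuples (S1 \<union> S2) p. \<Phi> (x # xs))
               = fact p * (\<Sum>a\<le>p. split_sum S1 S2 \<Phi> (Suc a) (p - a) / ?D a)"
    unfolding IH sum_distrib_left[symmetric]
    by (subst sum.swap) (simp only: sum_divide_distrib[symmetric] split_sum_Suc_left[OF assms(1)])
  have from_S2: "(\<Sum>x\<in>S2. \<Sum>xs\<in>tuples (S1 \<union> S2) p. \<Phi> (x # xs))
               = fact p * (\<Sum>a\<le>p. split_sum S1 S2 \<Phi> a (Suc (p - a)) / ?D a)"
    unfolding IH sum_distrib_left[symmetric]
    by (subst sum.swap) (simp only: sum_divide_distrib[symmetric] split_sum_Suc_right[OF assms(2) Suc.prems])
  have "(\<Sum>xs\<in>tuples (S1 \<union> S2) (Suc p). \<Phi> xs)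
      = (\<Sum>x\<in>S1. \<Sum>xs\<in>tuples (S1 \<union> S2) p. \<Phi> (x # xs))
        + (\<Sum>x\<in>S2. \<Sum>xs\<in>tuples (S1 \<union> S2) p. \<Phi> (x # xs))"
    using assms(1-3) by (simp add: sum_tuples_Suc sum.union_disjoint)
  also have "\<dots> = fact p * real (Suc p)
        * (\<Sum>a\<le>Suc p. split_sum S1 S2 \<Phi> a (Suc p - a) / (fact a * fact (Suc p - a)))"
    unfolding from_S1 from_S2 distrib_left[symmetric] pascal_recombine by (simp only: mult.assoc)
  finally show ?case by (simp add: fact_Suc mult_ac)
qed

section \<open>Poisson thinning\<close>

lemma poi_nonneg: "L \<ge> 0 \<Longrightarrow> poi L p \<ge> 0"
  unfolding poi_def by simp

lemma poi_sums: "poi L sums 1"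
proof -
  have "(\<lambda>n. L ^ n / fact n) sums exp L"
    using exp_converges[of L] by (simp add: divide_inverse_commute scaleR_conv_of_real)
  then have "(\<lambda>n. exp (- L) * (L ^ n / fact n)) sums (exp (- L) * exp L)"
    by (rule sums_mult)
  then show ?thesis unfolding poi_def by (simp add: exp_minus field_simps)
qed

lemma poi_summable: "summable (poi L)"
  using poi_sums by (rule sums_summable)

lemma poi_zero_rate: "poi 0 q = (if q = 0 then 1 else 0)"
  by (simp add: poi_def)

lemma summable_poi_bounded:
  assumes "L \<ge> 0" "\<And>m. \<bar>X m\<bar> \<le> B"
  shows "summable (\<lambda>m. poi L m * X m)"
proof (rule summable_comparison_test')
  show "summable (\<lambda>m. poi L m * B)" by (intro summable_mult2 poi_summable)
  show "norm (poi L m * X m) \<le> poi L m * B" for m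
    using poi_nonneg[OF assms(1), of m] assms(2)[of m] by (simp add: abs_mult mult_left_mono)
qed

lemma unif_avg_nested:
  "unif_avg S1 a (\<lambda>ys. unif_avg S2 b (\<lambda>zs. \<Phi> (ys @ zs)))
   = split_sum S1 S2 \<Phi> a b / (real (card S1) ^ a * real (card S2) ^ b)"
  unfolding unif_avg_def split_sum_def by (simp add: sum_divide_distrib field_simps)

lemma poisson_split_weight:
  fixes n1 n2 L T :: real
  assumes "n1 > 0" "n2 > 0" "a + b = p"
  shows "poi (L * (n1 / (n1 + n2))) a * poi (L * (n2 / (n1 + n2))) b * (T / (n1 ^ a * n2 ^ b))
         = exp (- L) * L ^ p / (n1 + n2) ^ p * (T / (fact a * fact b))"
proof -
  have fractions: "n1 / (n1 + n2) + n2 / (n1 + n2) = 1"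
    using assms by (simp add: add_divide_distrib[symmetric])
  have "exp (- (L * (n1 / (n1 + n2)))) * exp (- (L * (n2 / (n1 + n2))))
      = exp (- (L * (n1 / (n1 + n2) + n2 / (n1 + n2))))"
    by (simp add: exp_add[symmetric] distrib_left)
  then have exps: "exp (- (L * (n1 / (n1 + n2)))) * exp (- (L * (n2 / (n1 + n2)))) = exp (- L)"
    unfolding fractions by simp
  have powers: "(L * (n1 / (n1 + n2))) ^ a * (L * (n2 / (n1 + n2))) ^ b = L ^ p * n1 ^ a * n2 ^ b / (n1 + n2) ^ p"
    using assms(3)[symmetric] by (simp add: power_mult_distrib power_divide power_add field_simps)
  show ?thesis
    unfolding poi_def using assms exps powers by (simp add: field_simps)
qed

lemma poisson_thinning_term:
  fixes L :: real
  assumes "finite S1" "finite S2" "S1 \<inter> S2 = {}" "S1 \<noteq> {}" "S2 \<noteq> {}"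
    and perm: "perm_invariant \<Phi>"
  defines "L1 \<equiv> L * (real (card S1) / real (card (S1 \<union> S2)))"
    and "L2 \<equiv> L * (real (card S2) / real (card (S1 \<union> S2)))"
  shows "poi L p * unif_avg (S1 \<union> S2) p \<Phi>
         = (\<Sum>a\<le>p. poi L1 a * poi L2 (p - a) * unif_avg S1 a (\<lambda>ys. unif_avg S2 (p - a) (\<lambda>zs. \<Phi> (ys @ zs))))"
proof -
  define n1 where "n1 = real (card S1)"
  define n2 where "n2 = real (card S2)"
  have n1: "n1 > 0" and n2: "n2 > 0"
    using assms by (simp_all add: n1_def n2_def card_gt_0_iff)
  have card_union: "real (card (S1 \<union> S2)) = n1 + n2"
    using assms(1-3) by (simp add: card_Un_disjoint n1_def n2_def)
  have "(\<Sum>a\<le>p. poi L1 a * poi L2 (p - a) * unif_avg S1 a (\<lambda>ys. unif_avg S2 (p - a) (\<lambda>zs. \<Phi> (ys @ zs))))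
      = (\<Sum>a\<le>p. exp (- L) * L ^ p / (n1 + n2) ^ p * (split_sum S1 S2 \<Phi> a (p - a) / (fact a * fact (p - a))))"
    unfolding unif_avg_nested L1_def L2_def card_union n1_def[symmetric] n2_def[symmetric]
    by (intro sum.cong refl poisson_split_weight n1 n2) simp
  also have "\<dots> = exp (- L) * L ^ p / (n1 + n2) ^ p * ((\<Sum>xs\<in>tuples (S1 \<union> S2) p. \<Phi> xs) / fact p)"
  proof -
    have "(\<Sum>xs\<in>tuples (S1 \<union> S2) p. \<Phi> xs) / fact p
        = (\<Sum>a\<le>p. split_sum S1 S2 \<Phi> a (p - a) / (fact a * fact (p - a)))"
      using sum_tuples_union[OF assms(1-3) perm] by simp
    then show ?thesis by (simp add: sum_distrib_left)
  qed
  also have "\<dots> = poi L p * unif_avg (S1 \<union> S2) p \<Phi>"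
    unfolding poi_def unif_avg_def card_union by simp
  finally show ?thesis ..
qed

(* Interchange results for absolutely summable double series, needed to pass from
   summation along anti-diagonals (total number of draws) to iterated summation. *)
lemma suminf_eq_infsum:
  fixes f :: "nat \<Rightarrow> real"
  assumes "f summable_on UNIV"
  shows "suminf f = infsum f UNIV"
  using has_sum_imp_sums[OF has_sum_infsum[OF assms]] by (rule sums_unique[symmetric])

lemma double_series_as_infsum:
  fixes c :: "nat \<Rightarrow> nat \<Rightarrow> real"
  assumes "(\<lambda>(a, b). c a b) summable_on UNIV"
  shows "(\<Sum>a. \<Sum>b. c a b) = (\<Sum>\<^sub>\<infinity>(a, b). c a b)"
proof -
  have sigma: "(\<lambda>(a, b). c a b) summable_on (UNIV \<times> UNIV)"
    using assms by simp
  have "(\<Sum>a. \<Sum>b. c a b) = (\<Sum>a. infsum (c a) UNIV)"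
    using suminf_eq_infsum[OF summable_on_SigmaD1[OF sigma]] by simp
  also have "\<dots> = infsum (\<lambda>a. infsum (c a) UNIV) UNIV"
    by (rule suminf_eq_infsum[OF summable_on_Sigma_banach[OF sigma]])
  also have "\<dots> = (\<Sum>\<^sub>\<infinity>(a, b). c a b)"
    using infsum_Sigma'_banach[OF sigma] by simp
  finally show ?thesis .
qed

lemma diagonal_series_eq_double_series:
  fixes c :: "nat \<Rightarrow> nat \<Rightarrow> real"
  assumes summable: "(\<lambda>(a, b). c a b) summable_on UNIV"
  shows "(\<Sum>p. \<Sum>a\<le>p. c a (p - a)) = (\<Sum>a. \<Sum>b. c a b)"
proof -
  let ?D = "SIGMA p:(UNIV :: nat set). {..p}"
  have bij: "bij_betw (\<lambda>(p, a). (a, p - a)) ?D (UNIV \<times> UNIV)"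
    by (rule bij_betw_byWitness[where f'="\<lambda>(a::nat, b::nat). (a + b, a)"]) auto
  have diag: "(\<lambda>(p, a). c a (p - a)) summable_on ?D"
    using summable_on_reindex_bij_betw[OF bij, of "\<lambda>(a, b). c a b"] summable
    by (simp add: split_def)
  have "(\<Sum>p. \<Sum>a\<le>p. c a (p - a)) = (\<Sum>p. infsum (\<lambda>a. c a (p - a)) {..p})"
    by simp
  also have "\<dots> = infsum (\<lambda>p. infsum (\<lambda>a. c a (p - a)) {..p}) UNIV"
    by (rule suminf_eq_infsum[OF summable_on_Sigma_banach[OF diag]])
  also have "\<dots> = infsum (\<lambda>(p, a). c a (p - a)) ?D"
    by (rule infsum_Sigma'_banach[OF diag])
  also have "\<dots> = (\<Sum>\<^sub>\<infinity>(a, b). c a b)"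
    using infsum_reindex_bij_betw[OF bij, of "\<lambda>(a, b). c a b"] by (simp add: split_def)
  also have "\<dots> = (\<Sum>a. \<Sum>b. c a b)"
    by (rule double_series_as_infsum[OF summable, symmetric])
  finally show ?thesis .
qed

lemma product_summable_on:
  fixes u v :: "nat \<Rightarrow> real"
  assumes "summable u" "summable v" "\<And>a. u a \<ge> 0" "\<And>b. v b \<ge> 0"
  shows "(\<lambda>(a, b). u a * v b) summable_on UNIV"
proof -
  have hu: "(u has_sum suminf u) UNIV"
    by (rule sums_nonneg_imp_has_sum[OF summable_sums[OF assms(1)] assms(3)])
  have hv: "(v has_sum suminf v) UNIV"
    by (rule sums_nonneg_imp_has_sum[OF summable_sums[OF assms(2)] assms(4)])
  have "(\<lambda>(a, b). u a * v b) summable_on (UNIV \<times> UNIV)"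
  proof (rule summable_on_SigmaI[where g="\<lambda>a. u a * suminf v"])
    show "((\<lambda>b. case (a, b) of (a, b) \<Rightarrow> u a * v b) has_sum u a * suminf v) UNIV" for a
      using has_sum_cmult_right[OF hv, of "u a"] by simp
    show "(\<lambda>a. u a * suminf v) summable_on UNIV"
      using has_sum_cmult_left[OF hu, of "suminf v"] by (rule has_sum_imp_summable)
  qed (simp add: assms)
  then show ?thesis by simp
qed

lemma dominated_summable_on:
  fixes c :: "nat \<Rightarrow> nat \<Rightarrow> real"
  assumes "summable u" "summable v" "\<And>a. u a \<ge> 0" "\<And>b. v b \<ge> 0"
    and bound: "\<And>a b. \<bar>c a b\<bar> \<le> u a * v b"
  shows "(\<lambda>(a, b). c a b) summable_on UNIV"
proof -
  have "(\<lambda>(a, b). u a * v b) abs_summable_on UNIV"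
    using product_summable_on[OF assms(1-4)] summable_on_iff_abs_summable_on_real by blast
  then have "(\<lambda>(a, b). c a b) abs_summable_on UNIV"
    by (rule abs_summable_on_comparison_test) (auto simp: bound abs_mult assms(3,4) abs_of_nonneg)
  then show ?thesis
    using summable_on_iff_abs_summable_on_real by blast
qed

lemma unif_avg_bound:
  assumes "finite S" "\<And>xs. xs \<in> tuples S p \<Longrightarrow> \<bar>F xs\<bar> \<le> B" "B \<ge> 0"
  shows "\<bar>unif_avg S p F\<bar> \<le> B"
proof (cases "card S = 0 \<and> p > 0")
  case True
  then show ?thesis using assms(3) by (simp add: unif_avg_def power_0_left)
next
  case False
  then have pos: "real (card S) ^ p > 0" by auto
  have "\<bar>sum F (tuples S p)\<bar> \<le> (\<Sum>xs\<in>tuples S p. B)"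
    by (rule order_trans[OF sum_abs sum_mono]) (rule assms(2))
  also have "\<dots> = real (card S) ^ p * B"
    using card_lists_length_eq[OF assms(1)] by simp
  finally show ?thesis
    using pos by (simp add: unif_avg_def abs_divide divide_le_eq mult.commute)
qed

lemma poisson_thinning:
  fixes L :: real
  assumes "finite S1" "finite S2" "S1 \<inter> S2 = {}" "S1 \<noteq> {}" "S2 \<noteq> {}"
    and perm: "perm_invariant \<Phi>"
    and bound: "\<And>xs. \<bar>\<Phi> xs\<bar> \<le> B" and "L \<ge> 0"
  defines "L1 \<equiv> L * (real (card S1) / real (card (S1 \<union> S2)))"
    and "L2 \<equiv> L * (real (card S2) / real (card (S1 \<union> S2)))"
  shows "(\<Sum>p. poi L p * unif_avg (S1 \<union> S2) p \<Phi>)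
         = (\<Sum>a. \<Sum>b. poi L1 a * poi L2 b * unif_avg S1 a (\<lambda>ys. unif_avg S2 b (\<lambda>zs. \<Phi> (ys @ zs))))"
proof -
  have L1: "L1 \<ge> 0" and L2: "L2 \<ge> 0"
    using \<open>L \<ge> 0\<close> by (simp_all add: L1_def L2_def)
  have B: "B \<ge> 0"
    using bound[of "[]"] by simp
  have avg: "\<bar>unif_avg S1 a (\<lambda>ys. unif_avg S2 b (\<lambda>zs. \<Phi> (ys @ zs)))\<bar> \<le> B" for a b
    by (intro unif_avg_bound assms B bound)
  have "(\<lambda>(a, b). poi L1 a * poi L2 b * unif_avg S1 a (\<lambda>ys. unif_avg S2 b (\<lambda>zs. \<Phi> (ys @ zs))))
        summable_on UNIV"
  proof (rule dominated_summable_on[where u="\<lambda>a. B * poi L1 a" and v="poi L2"])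
    show "\<bar>poi L1 a * poi L2 b * unif_avg S1 a (\<lambda>ys. unif_avg S2 b (\<lambda>zs. \<Phi> (ys @ zs)))\<bar>
          \<le> B * poi L1 a * poi L2 b" for a b
      using mult_left_mono[OF avg, of "poi L1 a * poi L2 b" a b] poi_nonneg[OF L1, of a] poi_nonneg[OF L2, of b]
      by (simp add: abs_mult mult_ac)
  qed (simp_all add: summable_mult poi_summable poi_nonneg L1 L2 B)
  then show ?thesis
    unfolding poisson_thinning_term[OF assms(1-5) perm] L1_def L2_def
    by (rule diagonal_series_eq_double_series)
qed

section \<open>Uniform averages and the quenched expectation\<close>

lemma unif_avg_cong:
  assumes "\<And>xs. set xs \<subseteq> S \<Longrightarrow> length xs = p \<Longrightarrow> F xs = G xs"
  shows "unif_avg S p F = unif_avg S p G"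
  unfolding unif_avg_def using assms by (intro arg_cong2[where f="(/)"] sum.cong) auto

lemma unif_avg_const:
  assumes "finite S" "S \<noteq> {}"
  shows "unif_avg S p (\<lambda>_. k) = k"
  unfolding unif_avg_def using assms by (simp add: card_lists_length_eq)

lemma unif_avg_0: "unif_avg S 0 F = F []"
  unfolding unif_avg_def tuples_0 by simp

lemma unif_avg_suminf:
  assumes "finite T" and summable: "\<And>ys. summable (\<lambda>m. w m * X ys m)"
  shows "(\<Sum>m. c * w m * unif_avg T a (\<lambda>ys. X ys m)) = c * unif_avg T a (\<lambda>ys. \<Sum>m. w m * X ys m)"
proof -
  let ?k = "c / real (card T) ^ a"
  have "(\<Sum>m. c * w m * unif_avg T a (\<lambda>ys. X ys m)) = (\<Sum>m. ?k * (\<Sum>ys\<in>tuples T a. w m * X ys m))"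
    by (simp add: unif_avg_def sum_distrib_left[symmetric] mult_ac)
  also have "\<dots> = ?k * (\<Sum>m. \<Sum>ys\<in>tuples T a. w m * X ys m)"
    by (rule suminf_mult[OF summable_sum[OF summable]])
  also have "\<dots> = ?k * (\<Sum>ys\<in>tuples T a. \<Sum>m. w m * X ys m)"
    by (simp add: suminf_sum[OF summable])
  finally show ?thesis by (simp add: unif_avg_def)
qed

lemma sum_tuples_fibres:
  assumes "finite S" "finite T" "h ` S \<subseteq> T" "\<And>t. t \<in> T \<Longrightarrow> card {x\<in>S. h x = t} = m"
  shows "(\<Sum>xs\<in>tuples S p. F (map h xs)) = real m ^ p * (\<Sum>ts\<in>tuples T p. F ts)"
proof (induction p arbitrary: F)
  case 0
  show ?case unfolding tuples_0 by simp
next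
  case (Suc p)
  define G where "G t = (\<Sum>ts\<in>tuples T p. F (t # ts))" for t
  have "(\<Sum>xs\<in>tuples S (Suc p). F (map h xs)) = real m ^ p * (\<Sum>x\<in>S. G (h x))"
    using Suc.IH[of "\<lambda>l. F (h _ # l)"]
    by (simp add: sum_tuples_Suc[OF assms(1)] G_def sum_distrib_left)
  also have "(\<Sum>x\<in>S. G (h x)) = (\<Sum>t\<in>T. \<Sum>x\<in>{x\<in>S. h x = t}. G (h x))"
    by (rule sum.group[symmetric]) (use assms(1-3) in auto)
  also have "\<dots> = (\<Sum>t\<in>T. real m * G t)"
    using assms(4) by (intro sum.cong) auto
  finally show ?case
    by (simp add: sum_tuples_Suc[OF assms(2)] G_def sum_distrib_left mult_ac)
qed

lemma card_fibres:
  assumes "finite S" "finite T" "h ` S \<subseteq> T" "\<And>t. t \<in> T \<Longrightarrow> card {x\<in>S. h x = t} = m"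
  shows "card S = m * card T"
proof -
  have "card S = (\<Sum>t\<in>T. card {x\<in>S. h x = t})"
    using card_eq_sum sum.group[OF assms(1-3), of "\<lambda>_. 1::nat"] by simp
  then show ?thesis using assms(4) by simp
qed

lemma unif_avg_fibres:
  assumes "finite S" "finite T" "h ` S \<subseteq> T" "\<And>t. t \<in> T \<Longrightarrow> card {x\<in>S. h x = t} = m" "m > 0"
  shows "unif_avg S p (\<lambda>xs. F (map h xs)) = unif_avg T p F"
proof -
  have "(\<Sum>xs\<in>tuples S p. F (map h xs)) = real m ^ p * (\<Sum>ts\<in>tuples T p. F ts)"
    by (rule sum_tuples_fibres[OF assms(1-4)])
  moreover have "card S = m * card T"
    by (rule card_fibres[OF assms(1-4)])
  ultimately show ?thesis
    using assms(5) by (simp add: unif_avg_def power_mult_distrib)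
qed

lemma qexp_iterated:
  assumes "lam \<ge> 0" "mu \<ge> 0" and bound: "\<And>es ks. \<bar>F es ks\<bar> \<le> B"
  shows "qexp N lam mu F
         = (\<Sum>p. poi lam p * unif_avg ({1..N} \<times> {1..N}) p
                  (\<lambda>es. \<Sum>q. poi mu q * unif_avg {1..N} q (F es)))"
proof -
  have B: "B \<ge> 0"
    using bound[of "[]" "[]"] by simp
  have "summable (\<lambda>q. poi mu q * unif_avg {1..N} q (F es))" for es
    by (rule summable_poi_bounded[OF assms(2)], rule unif_avg_bound[where B=B]) (simp_all add: bound B)
  then show ?thesis
    unfolding qexp_def by (simp add: unif_avg_suminf)
qed

lemma qexp_no_fields:
  "qexp N lam 0 F = (\<Sum>p. poi lam p * unif_avg ({1..N} \<times> {1..N}) p (\<lambda>es. F es []))"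
proof -
  have "(\<Sum>q. poi lam p * poi 0 q * unif_avg A p (\<lambda>es. unif_avg K q (F es)))
      = poi lam p * unif_avg A p (\<lambda>es. F es [])" for p and A :: "(nat \<times> nat) set" and K :: "nat set"
  proof -
    have "(\<Sum>q. poi lam p * poi 0 q * unif_avg A p (\<lambda>es. unif_avg K q (F es)))
        = (\<Sum>q\<in>{0}. poi lam p * poi 0 q * unif_avg A p (\<lambda>es. unif_avg K q (F es)))"
      by (rule suminf_finite) (simp_all add: poi_zero_rate)
    then show ?thesis by (simp add: poi_zero_rate unif_avg_0)
  qed
  then show ?thesis unfolding qexp_def by simp
qed

section \<open>Spin configurations and Boltzmann states\<close>

lemma spins_pm: "\<sigma> \<in> spins N \<Longrightarrow> \<sigma> i = -1 \<or> \<sigma> i = 1"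
  unfolding spins_def by blast

lemma spins_outside: "\<sigma> \<in> spins N \<Longrightarrow> i \<notin> {1..N} \<Longrightarrow> \<sigma> i = 1"
  unfolding spins_def by blast

lemma spins_top: "\<sigma> \<in> spins N \<Longrightarrow> \<sigma> (N + 1) = 1"
  by (rule spins_outside) auto

lemma spins_finite: "finite (spins N)"
proof -
  have "spins N \<subseteq> (\<lambda>S i. if i \<in> S then -1 else 1) ` Pow {1..N}"
  proof
    fix \<sigma> assume s: "\<sigma> \<in> spins N"
    have "\<sigma> = (\<lambda>i. if i \<in> {i\<in>{1..N}. \<sigma> i = -1} then -1 else 1)"
      using spins_pm[OF s] spins_outside[OF s] by force
    then show "\<sigma> \<in> (\<lambda>S i. if i \<in> S then -1 else 1) ` Pow {1..N}"
      by blast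
  qed
  then show ?thesis by (rule finite_subset) simp
qed

lemma spins_nonempty: "(\<lambda>_. 1) \<in> spins N"
  unfolding spins_def by simp

lemma spins_Suc_top: "\<sigma> \<in> spins N \<longleftrightarrow> \<sigma> \<in> spins (N + 1) \<and> \<sigma> (N + 1) = 1"
  unfolding spins_def by (auto simp: le_Suc_eq)

lemma bweight_pos: "bweight \<beta> es ks \<sigma> > 0"
  unfolding bweight_def by simp

lemma mono_abs: "\<sigma> \<in> spins N \<Longrightarrow> \<bar>mono I \<sigma>\<bar> = 1"
proof -
  have "\<bar>\<sigma> i\<bar> = 1" if "\<sigma> \<in> spins N" for i
    using spins_pm[OF that, of i] by auto
  then show "\<sigma> \<in> spins N \<Longrightarrow> \<bar>mono I \<sigma>\<bar> = 1"
    unfolding mono_def by (induction I) (auto simp: abs_mult)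
qed

lemma gibbs_bound:
  assumes "\<And>\<sigma>. \<sigma> \<in> spins N \<Longrightarrow> \<bar>g \<sigma>\<bar> \<le> 1"
  shows "\<bar>gibbs N \<beta> es ks g\<bar> \<le> 1"
proof -
  let ?w = "bweight \<beta> es ks"
  have Z: "(\<Sum>\<sigma>\<in>spins N. ?w \<sigma>) > 0"
    by (rule sum_pos2[OF spins_finite spins_nonempty]) (simp_all add: less_imp_le bweight_pos)
  have "\<bar>\<Sum>\<sigma>\<in>spins N. g \<sigma> * ?w \<sigma>\<bar> \<le> (\<Sum>\<sigma>\<in>spins N. \<bar>g \<sigma>\<bar> * ?w \<sigma>)"
    using sum_abs[of "\<lambda>\<sigma>. g \<sigma> * ?w \<sigma>"] by (simp add: abs_mult less_imp_le[OF bweight_pos])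
  also have "\<dots> \<le> (\<Sum>\<sigma>\<in>spins N. ?w \<sigma>)"
    using assms by (intro sum_mono) (simp add: less_imp_le[OF bweight_pos] mult_left_le_one_le)
  finally show ?thesis
    using Z unfolding gibbs_def by (simp add: abs_divide)
qed

lemma gibbs_weight_cong:
  assumes "c > 0" "\<And>\<sigma>. \<sigma> \<in> spins N \<Longrightarrow> bweight \<beta> es ks \<sigma> = c * bweight \<beta> es' ks' \<sigma>"
  shows "gibbs N \<beta> es ks = gibbs N \<beta> es' ks'"
proof
  fix g
  have "(\<Sum>\<sigma>\<in>spins N. g \<sigma> * bweight \<beta> es ks \<sigma>) = c * (\<Sum>\<sigma>\<in>spins N. g \<sigma> * bweight \<beta> es' ks' \<sigma>)"
    and "(\<Sum>\<sigma>\<in>spins N. bweight \<beta> es ks \<sigma>) = c * (\<Sum>\<sigma>\<in>spins N. bweight \<beta> es' ks' \<sigma>)"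
    by (simp_all add: sum_distrib_left assms(2) mult_ac cong: sum.cong)
  then show "gibbs N \<beta> es ks g = gibbs N \<beta> es' ks' g"
    unfolding gibbs_def using assms(1) by simp
qed

section \<open>Gauge symmetry\<close>

definition flip :: "nat \<Rightarrow> (nat \<Rightarrow> real) \<Rightarrow> nat \<Rightarrow> real" where
  "flip M \<sigma> = (\<lambda>i. if i \<in> {1..M} then - \<sigma> i else \<sigma> i)"

lemma flip_flip: "flip M (flip M \<sigma>) = \<sigma>"
  unfolding flip_def by auto

lemma flip_spins: "\<sigma> \<in> spins M \<Longrightarrow> flip M \<sigma> \<in> spins M"
  unfolding spins_def flip_def by auto

lemma spins_Suc: "spins (N + 1) = spins N \<union> flip (N + 1) ` spins N"
proof
  show "spins N \<union> flip (N + 1) ` spins N \<subseteq> spins (N + 1)"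
    using spins_Suc_top flip_spins by blast
  show "spins (N + 1) \<subseteq> spins N \<union> flip (N + 1) ` spins N"
  proof
    fix \<sigma> assume s: "\<sigma> \<in> spins (N + 1)"
    show "\<sigma> \<in> spins N \<union> flip (N + 1) ` spins N"
    proof (cases "\<sigma> (N + 1) = 1")
      case True
      then show ?thesis using s spins_Suc_top by blast
    next
      case False
      then have "flip (N + 1) \<sigma> (N + 1) = 1"
        using spins_pm[OF s, of "N + 1"] by (simp add: flip_def)
      then have "flip (N + 1) \<sigma> \<in> spins N"
        using spins_Suc_top flip_spins[OF s] by blast
      then show ?thesis
        using flip_flip[of "N + 1" \<sigma>] by (metis UnI2 image_eqI)
    qed
  qed
qed

lemma mono_flip: "set I \<subseteq> {1..M} \<Longrightarrow> mono I (flip M \<sigma>) = (-1) ^ length I * mono I \<sigma>"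
  unfolding mono_def flip_def by (induction I) auto

lemma bweight_flip:
  assumes "set es \<subseteq> {1..M} \<times> {1..M}"
  shows "bweight \<beta> es [] (flip M \<sigma>) = bweight \<beta> es [] \<sigma>"
proof -
  have "map (\<lambda>(i, j). flip M \<sigma> i * flip M \<sigma> j) es = map (\<lambda>(i, j). \<sigma> i * \<sigma> j) es"
    using assms by (intro map_cong) (auto simp: flip_def)
  then show ?thesis unfolding bweight_def by (simp only: list.map sum_list.Nil)
qed

lemma sum_spins_Suc:
  "(\<Sum>\<sigma>\<in>spins (N + 1). h \<sigma>) = (\<Sum>\<sigma>\<in>spins N. h \<sigma>) + (\<Sum>\<sigma>\<in>spins N. h (flip (N + 1) \<sigma>))"
proof -
  have inj: "inj_on (flip (N + 1)) (spins N)"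
    by (rule inj_on_inverseI[where g="flip (N + 1)"]) (rule flip_flip)
  have "flip (N + 1) \<sigma> (N + 1) = -1" if "\<sigma> \<in> spins N" for \<sigma>
    using spins_top[OF that] by (simp add: flip_def)
  then have disjoint: "spins N \<inter> flip (N + 1) ` spins N = {}"
    using spins_top by fastforce
  have finite: "finite (flip (N + 1) ` spins N)"
    using spins_finite by simp
  show ?thesis
    unfolding spins_Suc sum.union_disjoint[OF spins_finite finite disjoint] sum.reindex[OF inj]
    by (simp add: o_def)
qed

lemma gibbs_gauge:
  assumes es: "set es \<subseteq> {1..N + 1} \<times> {1..N + 1}" and I: "set I \<subseteq> {1..N}"
  shows "gibbs (N + 1) \<beta> es [] (\<lambda>\<sigma>. mono I \<sigma> * \<sigma> (N + 1) ^ length I) = gibbs N \<beta> es [] (mono I)"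
proof -
  let ?w = "bweight \<beta> es []"
  let ?g = "\<lambda>\<sigma>. mono I \<sigma> * \<sigma> (N + 1) ^ length I"
  have g: "?g \<sigma> = mono I \<sigma>" and g_flip: "?g (flip (N + 1) \<sigma>) = mono I \<sigma>" if "\<sigma> \<in> spins N" for \<sigma>
  proof -
    show "?g \<sigma> = mono I \<sigma>"
      using spins_top[OF that] by simp
    have "flip (N + 1) \<sigma> (N + 1) = -1"
      using spins_top[OF that] by (simp add: flip_def)
    moreover have "set I \<subseteq> {1..N + 1}"
      using I by auto
    ultimately show "?g (flip (N + 1) \<sigma>) = mono I \<sigma>"
      by (simp add: mono_flip power_mult_distrib[symmetric])
  qed
  have w_flip: "?w (flip (N + 1) \<sigma>) = ?w \<sigma>" for \<sigma>
    by (rule bweight_flip[OF es])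
  have "(\<Sum>\<sigma>\<in>spins N. ?g \<sigma> * ?w \<sigma>) = (\<Sum>\<sigma>\<in>spins N. mono I \<sigma> * ?w \<sigma>)"
    and "(\<Sum>\<sigma>\<in>spins N. ?g (flip (N + 1) \<sigma>) * ?w \<sigma>) = (\<Sum>\<sigma>\<in>spins N. mono I \<sigma> * ?w \<sigma>)"
    by (simp_all only: g g_flip cong: sum.cong)
  then have "(\<Sum>\<sigma>\<in>spins (N + 1). ?g \<sigma> * ?w \<sigma>) = 2 * (\<Sum>\<sigma>\<in>spins N. mono I \<sigma> * ?w \<sigma>)"
    unfolding sum_spins_Suc[of "\<lambda>\<sigma>. ?g \<sigma> * ?w \<sigma>"] w_flip by simp
  moreover have "(\<Sum>\<sigma>\<in>spins (N + 1). ?w \<sigma>) = 2 * (\<Sum>\<sigma>\<in>spins N. ?w \<sigma>)"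
    unfolding sum_spins_Suc w_flip by simp
  ultimately show ?thesis
    unfolding gibbs_def by simp
qed

section \<open>The cavity spin\<close>

(* The links of the (N+1)-spin system fall into bulk links inside 1..N, cavity links
   joining some k in 1..N to the cavity spin N+1, and the self-loop at N+1.
   A cavity link is turned into a field at its partner site. *)
definition cavity_link :: "nat \<Rightarrow> nat \<Rightarrow> nat \<times> nat" where
  "cavity_link N k = (k, N + 1)"

definition bulk_links :: "nat \<Rightarrow> (nat \<times> nat) set" where
  "bulk_links N = {1..N} \<times> {1..N}"

definition cavity_links :: "nat \<Rightarrow> (nat \<times> nat) set" where
  "cavity_links N = cavity_link N ` {1..N} \<union> (\<lambda>k. (N + 1, k)) ` {1..N}"

definition cavity_loop :: "nat \<Rightarrow> (nat \<times> nat) set" where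
  "cavity_loop N = {(N + 1, N + 1)}"

definition cavity_partner :: "nat \<Rightarrow> nat \<times> nat \<Rightarrow> nat" where
  "cavity_partner N e = (if fst e = N + 1 then snd e else fst e)"

lemma bweight_fields:
  assumes "\<sigma> (N + 1) = 1"
  shows "bweight \<beta> es ks \<sigma> = bweight \<beta> (es @ map (cavity_link N) ks) [] \<sigma>"
  unfolding bweight_def cavity_link_def using assms by (simp add: o_def algebra_simps)

lemma bweight_mset:
  assumes "mset es = mset es'"
  shows "bweight \<beta> es ks \<sigma> = bweight \<beta> es' ks \<sigma>"
proof -
  let ?f = "\<lambda>(i, j). \<sigma> i * \<sigma> j"
  have "sum_list (map ?f es) = sum_mset (mset (map ?f es))"
    by (rule sum_mset_sum_list[symmetric])
  also have "\<dots> = sum_mset (mset (map ?f es'))"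
    using assms by (simp only: mset_map)
  also have "\<dots> = sum_list (map ?f es')"
    by (rule sum_mset_sum_list)
  finally show ?thesis unfolding bweight_def by simp
qed

lemma bweight_loops:
  assumes "set ws \<subseteq> cavity_loop N" "\<sigma> (N + 1) = 1"
  shows "bweight \<beta> (es @ ws) [] \<sigma> = exp (\<beta> * real (length ws)) * bweight \<beta> es [] \<sigma>"
proof -
  have "(\<Sum>(i, j)\<leftarrow>ws. \<sigma> i * \<sigma> j) = real (length ws)"
    using assms(1)
  proof (induction ws)
    case (Cons w ws)
    then show ?case using assms(2) by (auto simp: cavity_loop_def)
  qed simp
  then show ?thesis
    unfolding bweight_def by (simp add: algebra_simps exp_add[symmetric])
qed

lemma bweight_cavity:
  assumes "set zs \<subseteq> cavity_links N" "\<sigma> (N + 1) = 1"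
  shows "bweight \<beta> (ys @ zs) [] \<sigma> = bweight \<beta> (ys @ map (cavity_link N \<circ> cavity_partner N) zs) [] \<sigma>"
proof -
  have "map (\<lambda>(i, j). \<sigma> i * \<sigma> j) zs = map ((\<lambda>(i, j). \<sigma> i * \<sigma> j) \<circ> (cavity_link N \<circ> cavity_partner N)) zs"
    using assms by (intro map_cong) (auto simp: cavity_links_def cavity_link_def cavity_partner_def)
  then show ?thesis
    unfolding bweight_def by (simp only: map_append sum_list_append map_map list.map sum_list.Nil)
qed

(* The observable of the theorem for a fixed link sample: a product of Boltzmann
   moments of the N-spin system, fields encoded as links to the frozen spin N+1. *)
definition moment_prod :: "nat \<Rightarrow> real \<Rightarrow> nat list list \<Rightarrow> (nat \<times> nat) list \<Rightarrow> real" where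
  "moment_prod N \<beta> Is es = (\<Prod>I\<leftarrow>Is. gibbs N \<beta> es [] (mono I))"

lemma moment_prod_perm: "perm_invariant (moment_prod N \<beta> Is)"
  unfolding perm_invariant_def
proof (intro allI impI)
  fix es es' :: "(nat \<times> nat) list"
  assume perm: "mset es = mset es'"
  have "gibbs N \<beta> es [] = gibbs N \<beta> es' []"
    by (rule gibbs_weight_cong[of 1]) (simp_all add: bweight_mset[OF perm])
  then show "moment_prod N \<beta> Is es = moment_prod N \<beta> Is es'"
    unfolding moment_prod_def by simp
qed

lemma prod_list_abs_le_1: "(\<And>x. x \<in> set xs \<Longrightarrow> \<bar>f x\<bar> \<le> 1) \<Longrightarrow> \<bar>\<Prod>x\<leftarrow>xs. f x\<bar> \<le> (1::real)"
  by (induction xs) (auto simp: abs_mult intro: mult_le_one)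

lemma moment_prod_bound: "\<bar>moment_prod N \<beta> Is es\<bar> \<le> 1"
  unfolding moment_prod_def by (intro prod_list_abs_le_1 gibbs_bound) (simp add: mono_abs)

lemma moment_prod_loops:
  assumes "set ws \<subseteq> cavity_loop N"
  shows "moment_prod N \<beta> Is (es @ ws) = moment_prod N \<beta> Is es"
proof -
  have "gibbs N \<beta> (es @ ws) [] = gibbs N \<beta> es []"
    by (rule gibbs_weight_cong[of "exp (\<beta> * real (length ws))"])
      (simp_all add: bweight_loops[OF assms spins_top])
  then show ?thesis unfolding moment_prod_def by simp
qed

lemma moment_prod_cavity:
  assumes "set zs \<subseteq> cavity_links N"
  shows "moment_prod N \<beta> Is (ys @ zs) = moment_prod N \<beta> Is (ys @ map (cavity_link N \<circ> cavity_partner N) zs)"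
proof -
  have "gibbs N \<beta> (ys @ zs) [] = gibbs N \<beta> (ys @ map (cavity_link N \<circ> cavity_partner N) zs) []"
    by (rule gibbs_weight_cong[of 1]) (simp_all add: bweight_cavity[OF assms spins_top])
  then show ?thesis unfolding moment_prod_def by simp
qed

lemma moment_prod_fields:
  "(\<Prod>I\<leftarrow>Is. gibbs N \<beta> es ks (mono I)) = moment_prod N \<beta> Is (es @ map (cavity_link N) ks)"
proof -
  have "gibbs N \<beta> es ks = gibbs N \<beta> (es @ map (cavity_link N) ks) []"
    by (rule gibbs_weight_cong[of 1]) (simp_all add: bweight_fields[OF spins_top])
  then show ?thesis unfolding moment_prod_def by simp
qed

lemma moment_prod_gauge:
  assumes "set es \<subseteq> {1..N + 1} \<times> {1..N + 1}" "\<forall>I\<in>set Is. set I \<subseteq> {1..N}"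
  shows "(\<Prod>I\<leftarrow>Is. gibbs (N + 1) \<beta> es [] (\<lambda>\<sigma>. mono I \<sigma> * \<sigma> (N + 1) ^ length I))
         = moment_prod N \<beta> Is es"
  unfolding moment_prod_def using assms(2)
  by (intro arg_cong[where f=prod_list] map_cong refl gibbs_gauge[OF assms(1)]) auto

lemma link_decomposition:
  "{1..N + 1} \<times> {1..N + 1} = bulk_links N \<union> (cavity_links N \<union> cavity_loop N)"
  unfolding bulk_links_def cavity_links_def cavity_loop_def cavity_link_def by (auto simp: image_iff)

lemma link_sets_disjoint:
  "bulk_links N \<inter> (cavity_links N \<union> cavity_loop N) = {}" "cavity_links N \<inter> cavity_loop N = {}"
  unfolding bulk_links_def cavity_links_def cavity_loop_def cavity_link_def by auto

lemma link_sets_finite: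
  "finite (bulk_links N)" "finite (cavity_links N)" "finite (cavity_loop N)"
  unfolding bulk_links_def cavity_links_def cavity_loop_def by simp_all

lemma link_sets_nonempty:
  assumes "N \<ge> 1"
  shows "bulk_links N \<noteq> {}" "cavity_links N \<noteq> {}" "cavity_loop N \<noteq> {}"
  using assms unfolding bulk_links_def cavity_links_def cavity_loop_def by auto

lemma cavity_partner_image: "cavity_partner N ` cavity_links N \<subseteq> {1..N}"
  unfolding cavity_partner_def cavity_links_def cavity_link_def by auto

lemma cavity_partner_fibres:
  assumes "t \<in> {1..N}"
  shows "card {e \<in> cavity_links N. cavity_partner N e = t} = 2"
proof -
  have "{e \<in> cavity_links N. cavity_partner N e = t} = {(t, N + 1), (N + 1, t)}"
    using assms unfolding cavity_links_def cavity_link_def cavity_partner_def by auto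
  then show ?thesis using assms by simp
qed

lemma card_link_sets:
  "card ({1..N + 1} \<times> {1..N + 1}) = (N + 1) * (N + 1)"
  "card (bulk_links N) = N * N"
  "card (cavity_links N \<union> cavity_loop N) = 2 * N + 1"
proof -
  show "card ({1..N + 1} \<times> {1..N + 1}) = (N + 1) * (N + 1)" "card (bulk_links N) = N * N"
    by (simp_all add: bulk_links_def)
  have "card (cavity_links N) = 2 * N"
    using card_fibres[OF link_sets_finite(2) _ cavity_partner_image cavity_partner_fibres] by simp
  then show "card (cavity_links N \<union> cavity_loop N) = 2 * N + 1"
    using link_sets_finite link_sets_disjoint(2) by (simp add: card_Un_disjoint cavity_loop_def)
qed

(* A Poisson number of non-bulk links acts on the N-spin system like a Poisson number
   of fields at uniform sites: thin off the self-loops (which are irrelevant) and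
   identify each cavity link with its partner site (two links per site). *)
lemma cavity_links_as_fields:
  fixes \<Psi> :: "(nat \<times> nat) list \<Rightarrow> real" and L :: real
  assumes "N \<ge> 1" "L \<ge> 0" "perm_invariant \<Psi>" "\<And>zs. \<bar>\<Psi> zs\<bar> \<le> 1"
    and loops: "\<And>zs ws. set ws \<subseteq> cavity_loop N \<Longrightarrow> \<Psi> (zs @ ws) = \<Psi> zs"
    and cavity: "\<And>zs. set zs \<subseteq> cavity_links N \<Longrightarrow> \<Psi> zs = \<Psi> (map (cavity_link N \<circ> cavity_partner N) zs)"
  shows "(\<Sum>m. poi L m * unif_avg (cavity_links N \<union> cavity_loop N) m \<Psi>)
       = (\<Sum>q. poi (L * (2 * real N / (2 * real N + 1))) q * unif_avg {1..N} q (\<lambda>ks. \<Psi> (map (cavity_link N) ks)))"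
proof -
  let ?B = "cavity_links N" and ?C = "cavity_loop N"
  define L1 where "L1 = L * (real (card ?B) / real (card (?B \<union> ?C)))"
  define L2 where "L2 = L * (real (card ?C) / real (card (?B \<union> ?C)))"
  have L1: "L1 = L * (2 * real N / (2 * real N + 1))"
    using card_link_sets(3)[of N] card_fibres[OF link_sets_finite(2) _ cavity_partner_image cavity_partner_fibres]
    by (simp add: L1_def)
  have loops_avg: "unif_avg ?C c (\<lambda>ws. \<Psi> (zs @ ws)) = \<Psi> zs" for c zs
    using unif_avg_cong[of ?C c "\<lambda>ws. \<Psi> (zs @ ws)" "\<lambda>_. \<Psi> zs"] loops
      unif_avg_const[OF link_sets_finite(3) link_sets_nonempty(3)[OF assms(1)]] by simp
  have cavity_avg: "unif_avg ?B b \<Psi> = unif_avg {1..N} b (\<lambda>ks. \<Psi> (map (cavity_link N) ks))" for b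
  proof -
    have "unif_avg ?B b \<Psi> = unif_avg ?B b (\<lambda>zs. \<Psi> (map (cavity_link N) (map (cavity_partner N) zs)))"
      using cavity by (intro unif_avg_cong) simp
    also have "\<dots> = unif_avg {1..N} b (\<lambda>ks. \<Psi> (map (cavity_link N) ks))"
      by (rule unif_avg_fibres[OF link_sets_finite(2) _ cavity_partner_image cavity_partner_fibres]) auto
    finally show ?thesis .
  qed
  have "(\<Sum>m. poi L m * unif_avg (?B \<union> ?C) m \<Psi>)
      = (\<Sum>b. \<Sum>c. poi L1 b * poi L2 c * unif_avg ?B b (\<lambda>zs. unif_avg ?C c (\<lambda>ws. \<Psi> (zs @ ws))))"
    unfolding L1_def L2_def
    by (rule poisson_thinning[OF link_sets_finite(2,3) link_sets_disjoint(2)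
          link_sets_nonempty(2,3)[OF assms(1)] assms(3,4,2)])
  also have "\<dots> = (\<Sum>b. poi L1 b * unif_avg ?B b \<Psi>)"
  proof -
    have "(\<lambda>c. poi L1 b * unif_avg ?B b \<Psi> * poi L2 c) sums (poi L1 b * unif_avg ?B b \<Psi> * 1)" for b
      by (rule sums_mult[OF poi_sums])
    then show ?thesis
      unfolding loops_avg by (simp add: sums_iff mult_ac)
  qed
  finally show ?thesis
    unfolding cavity_avg L1 .
qed

lemma moment_prod_cavity_links_as_fields:
  assumes "N \<ge> 1" "L \<ge> 0"
  shows "(\<Sum>b. poi L b * unif_avg (cavity_links N \<union> cavity_loop N) b (\<lambda>zs. moment_prod N \<beta> Is (ys @ zs)))
       = (\<Sum>q. poi (L * (2 * real N / (2 * real N + 1))) q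
            * unif_avg {1..N} q (\<lambda>ks. moment_prod N \<beta> Is (ys @ map (cavity_link N) ks)))"
proof (rule cavity_links_as_fields[OF assms])
  show "perm_invariant (\<lambda>zs. moment_prod N \<beta> Is (ys @ zs))"
    by (rule perm_invariant_append[OF moment_prod_perm])
  show "\<bar>moment_prod N \<beta> Is (ys @ zs)\<bar> \<le> 1" for zs
    by (rule moment_prod_bound)
  show "moment_prod N \<beta> Is (ys @ zs @ ws) = moment_prod N \<beta> Is (ys @ zs)"
    if "set ws \<subseteq> cavity_loop N" for zs ws
    using moment_prod_loops[OF that, of \<beta> Is "ys @ zs"] by simp
  show "moment_prod N \<beta> Is (ys @ zs) = moment_prod N \<beta> Is (ys @ map (cavity_link N \<circ> cavity_partner N) zs)"
    if "set zs \<subseteq> cavity_links N" for zs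
    by (rule moment_prod_cavity[OF that])
qed

lemma qexp_gauge:
  assumes "\<forall>I\<in>set Is. set I \<subseteq> {1..N}"
  shows "qexp (N + 1) L 0
           (\<lambda>es ks. \<Prod>I\<leftarrow>Is. gibbs (N + 1) \<beta> es ks (\<lambda>\<sigma>. mono I \<sigma> * \<sigma> (N + 1) ^ length I))
         = (\<Sum>p. poi L p * unif_avg ({1..N + 1} \<times> {1..N + 1}) p (moment_prod N \<beta> Is))"
proof -
  have "unif_avg ({1..N + 1} \<times> {1..N + 1}) p
          (\<lambda>es. \<Prod>I\<leftarrow>Is. gibbs (N + 1) \<beta> es [] (\<lambda>\<sigma>. mono I \<sigma> * \<sigma> (N + 1) ^ length I))
        = unif_avg ({1..N + 1} \<times> {1..N + 1}) p (moment_prod N \<beta> Is)" for p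
    by (rule unif_avg_cong) (rule moment_prod_gauge[OF _ assms])
  then show ?thesis
    unfolding qexp_no_fields by simp
qed

lemma bulk_rate:
  fixes \<alpha> :: real
  shows "\<alpha> * real (N + 1) * (real (N * N) / real ((N + 1) * (N + 1))) = alpha_tilde N \<alpha> * real N"
proof -
  have "real (N + 1) > 0"
    by simp
  then show ?thesis
    unfolding alpha_tilde_def of_nat_mult by (simp add: field_simps del: of_nat_add of_nat_Suc)
qed

lemma cavity_rate:
  fixes \<alpha> :: real
  shows "\<alpha> * real (N + 1) * (real (2 * N + 1) / real ((N + 1) * (N + 1))) * (2 * real N / (2 * real N + 1))
         = 2 * alpha_tilde N \<alpha>"
proof -
  have c: "2 * real N + 1 = real (2 * N + 1)" "real (2 * N + 1) > 0" "real (N + 1) > 0"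
    by simp_all
  have "real (2 * N + 1) / real ((N + 1) * (N + 1)) * (2 * real N / (2 * real N + 1))
      = 2 * real N / real ((N + 1) * (N + 1))"
    unfolding c(1) using c(2) by simp
  then have "\<alpha> * real (N + 1) * (real (2 * N + 1) / real ((N + 1) * (N + 1))) * (2 * real N / (2 * real N + 1))
      = \<alpha> * real (N + 1) * (2 * real N / real ((N + 1) * (N + 1)))"
    by (simp only: mult.assoc)
  also have "\<dots> = 2 * alpha_tilde N \<alpha>"
    using c(3) unfolding alpha_tilde_def of_nat_mult by (simp add: field_simps del: of_nat_add of_nat_Suc)
  finally show ?thesis .
qed

section \<open>The cavity identity\<close>

(* The exact identity behind theorem2: gauge, thin the links into bulk links and
   non-bulk links, turn the non-bulk links into fields, and recognise the N-spin
   quenched expectation with link rate alpha~ N and field rate 2 alpha~. *)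
lemma cavity_identity:
  fixes \<alpha> \<beta> :: real
  assumes N: "N \<ge> 1" and "\<alpha> \<ge> 0" and Is: "\<forall>I\<in>set Is. set I \<subseteq> {1..N}"
  shows "qexp (N + 1) (\<alpha> * real (N + 1)) 0
           (\<lambda>es ks. \<Prod>I\<leftarrow>Is. gibbs (N + 1) \<beta> es ks (\<lambda>\<sigma>. mono I \<sigma> * \<sigma> (N + 1) ^ length I))
         = qexp N (alpha_tilde N \<alpha> * real N) (2 * alpha_tilde N \<alpha>)
           (\<lambda>es ks. \<Prod>I\<leftarrow>Is. gibbs N \<beta> es ks (mono I))"
proof -
  define \<Phi> where "\<Phi> = moment_prod N \<beta> Is"
  define L where "L = \<alpha> * real (N + 1)"
  define L2 where "L2 = L * (real (2 * N + 1) / real ((N + 1) * (N + 1)))"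
  let ?BC = "cavity_links N \<union> cavity_loop N"
  have L: "L \<ge> 0" and L2: "L2 \<ge> 0" and bulk_rate_nonneg: "alpha_tilde N \<alpha> * real N \<ge> 0"
    using \<open>\<alpha> \<ge> 0\<close> by (simp_all add: L_def L2_def alpha_tilde_def)
  have \<Phi>_bound: "\<bar>\<Phi> es\<bar> \<le> 1" for es
    unfolding \<Phi>_def by (rule moment_prod_bound)
  have BC_finite: "finite ?BC" and BC_nonempty: "?BC \<noteq> {}"
    using link_sets_finite link_sets_nonempty(2)[OF N] by simp_all
  have thinning: "(\<Sum>p. poi L p * unif_avg ({1..N + 1} \<times> {1..N + 1}) p \<Phi>)
      = (\<Sum>a. \<Sum>b. poi (alpha_tilde N \<alpha> * real N) a * poi L2 b
           * unif_avg (bulk_links N) a (\<lambda>ys. unif_avg ?BC b (\<lambda>zs. \<Phi> (ys @ zs))))"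
    using poisson_thinning[OF link_sets_finite(1) BC_finite link_sets_disjoint(1) link_sets_nonempty(1)[OF N]
        BC_nonempty moment_prod_perm moment_prod_bound L]
    unfolding link_decomposition[symmetric] card_link_sets L2_def L_def bulk_rate \<Phi>_def .
  have cavity: "(\<Sum>b. poi L2 b * unif_avg ?BC b (\<lambda>zs. \<Phi> (ys @ zs)))
      = (\<Sum>q. poi (2 * alpha_tilde N \<alpha>) q * unif_avg {1..N} q (\<lambda>ks. \<Phi> (ys @ map (cavity_link N) ks)))" for ys
    using moment_prod_cavity_links_as_fields[OF N L2, of \<beta> Is ys]
    unfolding \<Phi>_def L2_def L_def cavity_rate .
  have summable: "summable (\<lambda>b. poi L2 b * unif_avg ?BC b (\<lambda>zs. \<Phi> (ys @ zs)))" for ys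
    by (rule summable_poi_bounded[OF L2], rule unif_avg_bound[where B=1]) (simp_all add: link_sets_finite \<Phi>_bound)
  have "qexp (N + 1) L 0
      (\<lambda>es ks. \<Prod>I\<leftarrow>Is. gibbs (N + 1) \<beta> es ks (\<lambda>\<sigma>. mono I \<sigma> * \<sigma> (N + 1) ^ length I))
      = (\<Sum>a. poi (alpha_tilde N \<alpha> * real N) a
           * unif_avg (bulk_links N) a (\<lambda>ys. \<Sum>b. poi L2 b * unif_avg ?BC b (\<lambda>zs. \<Phi> (ys @ zs))))"
    unfolding qexp_gauge[OF Is] \<Phi>_def[symmetric] thinning
    by (simp add: unif_avg_suminf link_sets_finite summable)
  also have "\<dots> = qexp N (alpha_tilde N \<alpha> * real N) (2 * alpha_tilde N \<alpha>)
                    (\<lambda>es ks. \<Phi> (es @ map (cavity_link N) ks))"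
    unfolding cavity bulk_links_def
    by (rule qexp_iterated[symmetric, where B=1, OF bulk_rate_nonneg _ \<Phi>_bound])
      (use \<open>\<alpha> \<ge> 0\<close> in \<open>simp add: alpha_tilde_def\<close>)
  finally show ?thesis
    unfolding L_def \<Phi>_def moment_prod_fields .
qed

(* The identity is exact, so the bound holds with C = 0. *)
theorem theorem2:
  fixes \<alpha> \<beta> t :: real and ns :: "nat list"
  assumes "\<alpha> > 0" and "t = 1" and "\<forall>n\<in>set ns. n \<ge> 1"
  shows "\<exists>C. \<forall>N\<ge>1. \<forall>Is :: nat list list.
           map length Is = ns \<and> (\<forall>I\<in>set Is. set I \<subseteq> {1..N}) \<longrightarrow>
           \<bar>qexp N (alpha_tilde N \<alpha> * real N) (2 * alpha_tilde N \<alpha> * t)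
               (\<lambda>es ks. \<Prod>I\<leftarrow>Is. gibbs N \<beta> es ks (mono I))
            - qexp (N + 1) (\<alpha> * real (N + 1)) 0
               (\<lambda>es ks. \<Prod>I\<leftarrow>Is. gibbs (N + 1) \<beta> es ks
                    (\<lambda>\<sigma>. mono I \<sigma> * \<sigma> (N + 1) ^ length I))\<bar>
           \<le> C / real N"
proof (intro exI[of _ 0] allI impI)
  fix N :: nat and Is :: "nat list list"
  assume "N \<ge> 1" and "map length Is = ns \<and> (\<forall>I\<in>set Is. set I \<subseteq> {1..N})"
  then have "qexp (N + 1) (\<alpha> * real (N + 1)) 0
               (\<lambda>es ks. \<Prod>I\<leftarrow>Is. gibbs (N + 1) \<beta> es ks (\<lambda>\<sigma>. mono I \<sigma> * \<sigma> (N + 1) ^ length I))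
             = qexp N (alpha_tilde N \<alpha> * real N) (2 * alpha_tilde N \<alpha> * t)
               (\<lambda>es ks. \<Prod>I\<leftarrow>Is. gibbs N \<beta> es ks (mono I))"
    using cavity_identity[of N \<alpha> Is \<beta>] assms(1,2) by simp
  then show "\<bar>qexp N (alpha_tilde N \<alpha> * real N) (2 * alpha_tilde N \<alpha> * t)
               (\<lambda>es ks. \<Prod>I\<leftarrow>Is. gibbs N \<beta> es ks (mono I))
            - qexp (N + 1) (\<alpha> * real (N + 1)) 0
               (\<lambda>es ks. \<Prod>I\<leftarrow>Is. gibbs (N + 1) \<beta> es ks
                    (\<lambda>\<sigma>. mono I \<sigma> * \<sigma> (N + 1) ^ length I))\<bar>
           \<le> 0 / real N"
    by simp
qed

end
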